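(* Let $(\alpha,\beta)\in\mathbb{N}^2\setminus\{(0,0)\}$ and let $W^{CT}$ be the limit random variable (defined in the context) of the continuous-time urn process started from $(\alpha,\beta)$. Then the support of (the distribution of) $W^{CT}$ is $\mathbb{R}$.
   Context: Standing assumptions (balanced, large, nontriangular urn): $m,S,b$ are integers with $m+2\le S\le 2m-1$ and $1\le b\le S-m-1$; put $a=S-b$, $c=S-m-b$, $d=m+b$. $(U^{CT}(t))_{t\ge0}$ is the Markov jump process on $\mathbb{N}^2\setminus\{(0,0)\}$ started at $(\alpha,\beta)$ which, from a state $(x,y)$, jumps to $(x+a,y+b)$ at rate $x$ and to $(x+c,y+d)$ at rate $y$. With $u_2(x,y)=\frac1S(bx-cy)$, $W^{CT}=\lim_{t\to+\infty}e^{-mt}u_2(U^{CT}(t))$ (limit a.s. and in every $L^p$, $p\ge1$). *)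

theory Defs
  imports "HOL-Probability.Probability"
begin

definition exit_rate :: "('s \<Rightarrow> 's \<Rightarrow> real) \<Rightarrow> 's \<Rightarrow> real" where
  "exit_rate q z = (\<Sum>\<^sub>\<infinity>z'\<in>UNIV. q z z')"

text \<open>
  Markov jump process on a countable state space with jump rates \<open>q z z'\<close>, in its jump
  chain / holding time form: \<open>T n\<close> is the time of the \<open>n\<close>-th jump and \<open>Y n\<close> the state
  occupied on \<open>[T n, T (n + 1))\<close>.  The product formula gives the joint law of \<open>Y\<close> and of the
  holding times: from \<open>z\<close> the process waits an exponential time of parameter \<open>exit_rate q z\<close>
  and then, independently, moves to \<open>z'\<close> with probability \<open>q z z' / exit_rate q z\<close>.  Only
  finitely many jumps occur in bounded time.  The convention is \<open>q z z = 0\<close>, and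
  no state that can be reached from \<open>z0\<close> is absorbing.
\<close>

definition markov_jump_process ::
  "'w measure \<Rightarrow> ('s \<Rightarrow> 's \<Rightarrow> real) \<Rightarrow> 's \<Rightarrow> (real \<Rightarrow> 'w \<Rightarrow> 's) \<Rightarrow> bool"
where
  "markov_jump_process M q z0 U \<longleftrightarrow>
     prob_space M \<and>
     (\<forall>t\<ge>0. U t \<in> measurable M (count_space UNIV)) \<and>
     (\<exists>(T :: nat \<Rightarrow> 'w \<Rightarrow> real) (Y :: nat \<Rightarrow> 'w \<Rightarrow> 's).
        (\<forall>n. T n \<in> borel_measurable M) \<and>
        (\<forall>n. Y n \<in> measurable M (count_space UNIV)) \<and>
        (AE \<omega> in M. T 0 \<omega> = 0 \<and> Y 0 \<omega> = z0 \<and>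
           (\<forall>n. T n \<omega> < T (Suc n) \<omega>) \<and>
           filterlim (\<lambda>n. T n \<omega>) at_top sequentially \<and>
           (\<forall>n t. T n \<omega> \<le> t \<and> t < T (Suc n) \<omega> \<longrightarrow> U t \<omega> = Y n \<omega>)) \<and>
        (\<forall>(n :: nat) (z :: nat \<Rightarrow> 's) (s :: nat \<Rightarrow> real).
           z 0 = z0 \<longrightarrow> (\<forall>i<n. 0 \<le> s i) \<longrightarrow>
           measure M {\<omega> \<in> space M. \<forall>i<n. T (Suc i) \<omega> - T i \<omega> > s i \<and> Y (Suc i) \<omega> = z (Suc i)}
             = (\<Prod>i<n. q (z i) (z (Suc i)) / exit_rate q (z i)
                      * exp (- exit_rate q (z i) * s i))))"

text \<open>
  Urn parameters: \<open>a = S - b\<close>, \<open>c = S - m - b\<close>, \<open>d = m + b\<close>.  The conversions \<open>nat\<close> are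
  harmless, since \<open>m + 2 \<le> S \<le> 2 * m - 1\<close> and \<open>1 \<le> b \<le> S - m - 1\<close> make \<open>a\<close>, \<open>b\<close>, \<open>c\<close>,
  \<open>d\<close> positive.  The two target states below are distinct (\<open>a - c = m\<close>) and differ from
  \<open>(x, y)\<close>; \<open>(0, 0)\<close> is never entered.
\<close>

definition urn_rate :: "int \<Rightarrow> int \<Rightarrow> int \<Rightarrow> nat \<times> nat \<Rightarrow> nat \<times> nat \<Rightarrow> real" where
  "urn_rate m S b = (\<lambda>(x, y) z'.
     (if z' = (x + nat (S - b), y + nat b) then real x else 0) +
     (if z' = (x + nat (S - m - b), y + nat (m + b)) then real y else 0))"

definition u2 :: "int \<Rightarrow> int \<Rightarrow> int \<Rightarrow> nat \<times> nat \<Rightarrow> real" where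
  "u2 m S b = (\<lambda>(x, y). (real_of_int b * real x - real_of_int (S - m - b) * real y) / real_of_int S)"

definition measure_support :: "'a::topological_space measure \<Rightarrow> 'a set" where
  "measure_support \<mu> = {x. \<forall>V. open V \<and> x \<in> V \<longrightarrow> emeasure \<mu> V > 0}"

end

theory Submission
  imports Defs "HOL-Real_Asymp.Real_Asymp"
begin

text \<open>
  The urn is balanced: every jump adds \<open>S\<close> balls, so the exit rate after \<open>i\<close> jumps is the
  deterministic number \<open>mass i\<close>.  Hence the holding times are independent exponential
  variables of known parameters, and they are independent of the embedded chain \<open>Y\<close>.  Along
  the jump times \<open>T n\<close> the limit is \<open>W = lim exp (- m * T n) * u2 (Y n)\<close>, and for every
  \<open>N\<close> it factorises as \<open>W = exp (- m * T N) * R\<close>, where \<open>R\<close> is the same limit for the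
  process restarted at its \<open>N\<close>-th jump.

  Given the first \<open>N\<close> states, \<open>R\<close> is the limit of a martingale started at
  \<open>v = u2 (Y N)\<close>, and its conditional variance is at most linear in \<open>mass N\<close>.  This is
  where largeness of the urn enters: the increment at step \<open>n\<close> contributes
  \<open>exp (- 2 * m * (T n - T N))\<close>, whose expectations decay like \<open>n powr (- 2 * m / S)\<close> and
  are summable because \<open>2 * m > S\<close>.  On the other hand, by always drawing the same colour
  the chain makes \<open>v\<close> grow linearly in \<open>N\<close>, with either sign.  So \<open>v\<^sup>2\<close> dominates the
  variance for large \<open>N\<close>, and by Chebyshev's inequality \<open>R\<close> lies within relative error
  \<open>\<delta>\<close> of \<open>v\<close> with positive probability.

  Now let \<open>w \<noteq> 0\<close> and take a path as above for which \<open>v\<close> has the sign of \<open>w\<close> and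
  \<open>\<bar>v\<bar>\<close> is larger than \<open>\<bar>w\<bar>\<close>.  The time \<open>T N\<close> falls close to \<open>ln (v / w) / m\<close> with positive
  probability, independently of the path and of \<open>R\<close>.  On the intersection of these events
  \<open>W\<close> is close to \<open>w\<close>.  Thus every nonzero real is in the support, and \<open>0\<close> follows because
  the support is closed.

  The law of the path and of the holding times is \<open>expectation_path_holding\<close>; the moments of
  the martingale are obtained by backward induction over the jumps in
  \<open>backward_supermartingale_bound\<close>, which gives the variance estimate \<open>window_variance\<close>;
  \<open>limit_near_restart_mean\<close> is the Chebyshev step, \<open>far_path\<close> constructs the path, and
  \<open>limit_hits_neighbourhood\<close> combines them.
\<close>

section \<open>Exponential holding times\<close>

definition exp_law :: "real \<Rightarrow> real measure" where
  "exp_law r = density lborel (exponential_density r)"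

lemma sets_exp_law [simp, measurable_cong]: "sets (exp_law r) = sets borel"
  by (simp add: exp_law_def)

lemma space_exp_law [simp]: "space (exp_law r) = UNIV"
  by (simp add: exp_law_def)

lemma prob_space_exp_law: "0 < r \<Longrightarrow> prob_space (exp_law r)"
  unfolding exp_law_def by (rule prob_space_exponential_density)

lemma integral_exp_law:
  assumes "0 < r" "f \<in> borel_measurable borel"
  shows "(\<integral>x. f x \<partial>exp_law r) = (\<integral>x. exponential_density r x * f x \<partial>lborel)"
  unfolding exp_law_def using assms
  by (intro integral_real_density) (auto simp: exponential_density_nonneg)

text \<open>
  Allowing negative thresholds matters below: half-lines with arbitrary end points determine a
  measure on the reals, whereas those with nonnegative end points do not.
\<close>
lemma measure_exp_law_tail:
  assumes "0 < r"
  shows "measure (exp_law r) {s<..} = exp (- r * max 0 s)"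
proof -
  interpret prob_space "exp_law r" by (rule prob_space_exp_law[OF assms])
  have "distr (exp_law r) lborel (\<lambda>x. x) = exp_law r"
    by (rule distr_id2) simp
  then have D: "distributed (exp_law r) lborel (\<lambda>x. x) (exponential_density r)"
    using assms by (auto simp: distributed_def exp_law_def)
  have ge: "measure (exp_law r) {s<..} = exp (- r * s)" if "0 \<le> s" for s
    using exponential_distributedD_gt[OF D that assms]
    by (simp add: greaterThan_def mult.commute)
  show ?thesis
  proof (cases "0 \<le> s")
    case False
    have "measure (exp_law r) {0<..} \<le> measure (exp_law r) {s<..}"
      using False by (intro finite_measure_mono) auto
    then have "measure (exp_law r) {s<..} = 1"
      using ge[of 0] prob_le_1[of "{s<..}"] by auto
    then show ?thesis using False by simp
  qed (simp add: ge)
qed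

lemma expectation_exp_law_exp:
  assumes "0 < r" "0 \<le> k"
  shows "(\<integral>x. exp (- k * x) \<partial>exp_law r) = r / (r + k)"
proof -
  have rk: "0 < r + k" using assms by simp
  interpret prob_space "exp_law (r + k)" by (rule prob_space_exp_law[OF rk])
  have "(\<integral>x. exp (- k * x) \<partial>exp_law r) = (\<integral>x. exponential_density r x * exp (- k * x) \<partial>lborel)"
    using assms by (intro integral_exp_law) auto
  also have "\<dots> = (\<integral>x. r / (r + k) * (exponential_density (r + k) x * 1) \<partial>lborel)"
  proof (intro Bochner_Integration.integral_cong refl)
    fix x
    have "exp (- x * r) * exp (- k * x) = exp (- x * (r + k))"
      by (simp add: mult_exp_exp algebra_simps)
    then show "exponential_density r x * exp (- k * x)
        = r / (r + k) * (exponential_density (r + k) x * 1)"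
      using rk by (simp add: exponential_density_def)
  qed
  also have "\<dots> = r / (r + k) * (\<integral>x. exponential_density (r + k) x * 1 \<partial>lborel)"
    by (rule integral_mult_right_zero)
  also have "(\<integral>x. exponential_density (r + k) x * 1 \<partial>lborel) = (\<integral>x. 1 \<partial>exp_law (r + k))"
    using rk by (intro integral_exp_law[symmetric]) auto
  also have "\<dots> = 1" using prob_space by simp
  finally show ?thesis by simp
qed

text \<open>
  The joint tail probabilities on the event \<open>C\<close> determine the joint law of the times on \<open>C\<close>,
  in the form in which it is used: expectations of products.  The factors are freed one
  at a time.  With all but the \<open>j\<close>-th factor fixed, both sides are integrals of \<open>g j\<close> against
  finite measures on the reals, and these agree on half-lines by the previous stage.  The bound
  by \<open>1\<close> is required only on the positive axis, so that \<open>exp (- k * x)\<close> is covered.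
\<close>
lemma (in prob_space) expectation_prod_exponential_times:
  fixes X :: "nat \<Rightarrow> 'a \<Rightarrow> real" and g :: "nat \<Rightarrow> real \<Rightarrow> real"
  assumes C[measurable]: "C \<in> events"
    and X[measurable]: "\<And>i. X i \<in> borel_measurable M"
    and r: "\<And>i. 0 < r i"
    and pos: "AE \<omega> in M. \<forall>i. 0 < X i \<omega>"
    and tails: "\<And>s. (\<forall>i<n. 0 \<le> s i) \<Longrightarrow>
      prob {\<omega> \<in> C. \<forall>i<n. s i < X i \<omega>} = c * (\<Prod>i<n. exp (- r i * s i))"
    and g: "\<And>i. g i \<in> borel_measurable borel" "\<And>i x. 0 \<le> g i x" "\<And>i x. 0 < x \<Longrightarrow> g i x \<le> 1"
  shows "expectation (\<lambda>\<omega>. indicator C \<omega> * (\<Prod>i<n. g i (X i \<omega>)))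
       = c * (\<Prod>i<n. \<integral>x. g i x \<partial>exp_law (r i))"
proof -
  have c: "0 \<le> c" using tails[of "\<lambda>_. 0"] by (auto simp: measure_nonneg dest: sym)
  \<comment> \<open>Induction on the number \<open>j\<close> of factors that are no longer indicators of half-lines.\<close>
  have "expectation (\<lambda>\<omega>. indicator C \<omega> * (\<Prod>i<n. f i (X i \<omega>)))
       = c * (\<Prod>i<n. \<integral>x. f i x \<partial>exp_law (r i))"
    if "j \<le> n" and fm: "\<And>i. f i \<in> borel_measurable borel" and f0: "\<And>i x. 0 \<le> f i x"
      and f1: "\<And>i x. 0 < x \<Longrightarrow> f i x \<le> 1"
      and tl: "\<And>i. j \<le> i \<Longrightarrow> i < n \<Longrightarrow> \<exists>s. f i = indicator {s<..}" for j f
    using that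
  proof (induction j arbitrary: f)
    case 0
    then have "\<forall>i. \<exists>s. i < n \<longrightarrow> f i = indicator {s<..}" by blast
    then obtain s where s: "\<And>i. i < n \<Longrightarrow> f i = indicator {s i<..}" by metis
    have [simp]: "(\<Prod>i<n. indicator {s i<..} (X i \<omega>)) = (of_bool (\<forall>i<n. s i < X i \<omega>) :: real)" for \<omega>
      by (induction n) (auto simp: indicator_def less_Suc_eq)
    have "expectation (\<lambda>\<omega>. indicator C \<omega> * (\<Prod>i<n. f i (X i \<omega>)))
        = expectation (indicator {\<omega> \<in> C. \<forall>i<n. max 0 (s i) < X i \<omega>})"
    proof (rule integral_cong_AE)
      show "AE \<omega> in M. indicator C \<omega> * (\<Prod>i<n. f i (X i \<omega>))
          = indicator {\<omega> \<in> C. \<forall>i<n. max 0 (s i) < X i \<omega>} \<omega>"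
        using pos by eventually_elim (auto simp: s indicator_def)
    qed (use 0 in measurable)
    also have "\<dots> = prob {\<omega> \<in> C. \<forall>i<n. max 0 (s i) < X i \<omega>}" by simp
    also have "\<dots> = c * (\<Prod>i<n. exp (- r i * max 0 (s i)))" by (rule tails) auto
    also have "\<dots> = c * (\<Prod>i<n. \<integral>x. f i x \<partial>exp_law (r i))"
      by (simp add: s measure_exp_law_tail[OF r])
    finally show ?case .
  next
    case (Suc j)
    have j: "j \<in> {..<n}" using Suc.prems by simp
    note [measurable] = Suc.prems(2)
    define h where "h \<omega> = indicator C \<omega> * (\<Prod>i\<in>{..<n} - {j}. f i (X i \<omega>))" for \<omega>
    define D where "D = c * (\<Prod>i\<in>{..<n} - {j}. \<integral>x. f i x \<partial>exp_law (r i))"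
    have [measurable]: "h \<in> borel_measurable M" unfolding h_def by measurable
    have h0: "0 \<le> h \<omega>" for \<omega> unfolding h_def by (intro mult_nonneg_nonneg prod_nonneg) (auto simp: Suc.prems)
    have h1: "AE \<omega> in M. h \<omega> \<le> 1"
      using pos by eventually_elim
        (auto simp: h_def indicator_def intro!: prod_le_1 Suc.prems)
    have D0: "0 \<le> D" unfolding D_def using c Suc.prems(3)
      by (intro mult_nonneg_nonneg prod_nonneg) auto
    have split: "(\<Prod>i<n. F i) = F j * (\<Prod>i\<in>{..<n} - {j}. F i)" for F :: "nat \<Rightarrow> real"
      using j by (intro prod.remove) auto
    define \<nu> where "\<nu> = distr (density M h) borel (X j)"
    define \<mu> where "\<mu> = density (exp_law (r j)) (\<lambda>_. D)"
    have hint: "integrable M (\<lambda>\<omega>. h \<omega> * indicator {x<..} (X j \<omega>))" for x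
      by (rule integrable_const_bound[where B=1]) (use h1 h0 in \<open>auto simp: indicator_def\<close>)
    have tail: "emeasure \<nu> {x<..} = emeasure \<mu> {x<..}" for x
    proof -
      have "emeasure \<nu> {x<..} = emeasure (density M h) (X j -` {x<..} \<inter> space M)"
        unfolding \<nu>_def by (subst emeasure_distr) auto
      also have "\<dots> = (\<integral>\<^sup>+\<omega>. ennreal (h \<omega>) * indicator (X j -` {x<..} \<inter> space M) \<omega> \<partial>M)"
        by (rule emeasure_density) measurable
      also have "\<dots> = (\<integral>\<^sup>+\<omega>. ennreal (h \<omega> * indicator {x<..} (X j \<omega>)) \<partial>M)"
        by (intro nn_integral_cong) (auto simp: indicator_def)
      also have "\<dots> = ennreal (expectation (\<lambda>\<omega>. h \<omega> * indicator {x<..} (X j \<omega>)))"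
        using h0 by (intro nn_integral_eq_integral hint) auto
      also have "expectation (\<lambda>\<omega>. h \<omega> * indicator {x<..} (X j \<omega>))
          = expectation (\<lambda>\<omega>. indicator C \<omega> * (\<Prod>i<n. (f(j := indicator {x<..})) i (X i \<omega>)))"
        by (intro Bochner_Integration.integral_cong) (auto simp: split h_def)
      also have "\<dots> = c * (\<Prod>i<n. \<integral>y. (f(j := indicator {x<..})) i y \<partial>exp_law (r i))"
      proof (intro Suc.IH)
        fix i assume "j \<le> i" "i < n"
        then show "\<exists>s. (f(j := indicator {x<..})) i = indicator {s<..}"
          using Suc.prems(5)[of i] by (cases "i = j") auto
      qed (use Suc.prems in \<open>auto simp: indicator_def\<close>)
      also have "\<dots> = D * measure (exp_law (r j)) {x<..}"
        by (auto simp: split D_def)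
      also have "ennreal \<dots> = emeasure \<mu> {x<..}"
        unfolding \<mu>_def
        using D0 by (subst emeasure_density_const)
          (auto simp: finite_measure.emeasure_eq_measure[OF prob_space.finite_measure[OF prob_space_exp_law[OF r]]] ennreal_mult)
      finally show ?thesis .
    qed
    have fin: "emeasure \<nu> {x<..} < \<infinity>" for x
      unfolding tail unfolding \<mu>_def
      by (subst emeasure_density_const)
         (auto simp: finite_measure.emeasure_eq_measure[OF prob_space.finite_measure[OF prob_space_exp_law[OF r]]] ennreal_mult_less_top)
    have eq: "\<nu> = \<mu>"
      by (rule measure_eqI_lessThan) (use tail fin in \<open>auto simp: \<nu>_def \<mu>_def\<close>)
    have "expectation (\<lambda>\<omega>. indicator C \<omega> * (\<Prod>i<n. f i (X i \<omega>))) = expectation (\<lambda>\<omega>. h \<omega> * f j (X j \<omega>))"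
      by (intro Bochner_Integration.integral_cong) (auto simp: split h_def)
    also have "\<dots> = (\<integral>\<omega>. f j (X j \<omega>) \<partial>density M h)"
      using h0 by (intro integral_real_density[symmetric]) auto
    also have "\<dots> = (\<integral>x. f j x \<partial>\<nu>)"
      unfolding \<nu>_def by (intro integral_distr[symmetric]) auto
    also have "\<dots> = (\<integral>x. D * f j x \<partial>exp_law (r j))"
      unfolding eq \<mu>_def using D0 by (intro integral_real_density) auto
    also have "\<dots> = c * (\<Prod>i<n. \<integral>x. f i x \<partial>exp_law (r i))"
      by (auto simp: split D_def)
    finally show ?case .
  qed
  from this[of n g] show ?thesis using g by auto
qed

section \<open>The embedded chain of a balanced urn\<close>

lemma exit_rate_finite_support:
  assumes "finite A" "\<And>z'. z' \<notin> A \<Longrightarrow> q z z' = 0"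
  shows "exit_rate q z = (\<Sum>z'\<in>A. q z z')"
proof -
  have "exit_rate q z = (\<Sum>\<^sub>\<infinity>z'\<in>A. q z z')"
    unfolding exit_rate_def by (rule infsum_cong_neutral) (use assms in auto)
  then show ?thesis using assms by simp
qed

text \<open>
  Only the jump times and the states at these times matter, because the limit of the
  continuous-time process is also its limit along the jump times.
\<close>
locale urn_jump_chain = prob_space M for M :: "'w measure" +
  fixes m S b :: int and z0 :: "nat \<times> nat"
    and T :: "nat \<Rightarrow> 'w \<Rightarrow> real" and Y :: "nat \<Rightarrow> 'w \<Rightarrow> nat \<times> nat"
  assumes large: "m + 2 \<le> S" "S \<le> 2 * m - 1" "1 \<le> b" "b \<le> S - m - 1"
    and start: "z0 \<noteq> (0, 0)"
    and T_measurable [measurable]: "\<And>n. T n \<in> borel_measurable M"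
    and Y_measurable [measurable]: "\<And>n. Y n \<in> measurable M (count_space UNIV)"
    and T_0: "AE \<omega> in M. T 0 \<omega> = 0"
    and T_strict: "AE \<omega> in M. \<forall>n. T n \<omega> < T (Suc n) \<omega>"
    and jump_law: "\<And>(n :: nat) z s. z 0 = z0 \<Longrightarrow> \<forall>i<n. 0 \<le> s i \<Longrightarrow>
      prob {\<omega> \<in> space M. \<forall>i<n. T (Suc i) \<omega> - T i \<omega> > s i \<and> Y (Suc i) \<omega> = z (Suc i)}
        = (\<Prod>i<n. urn_rate m S b (z i) (z (Suc i)) / exit_rate (urn_rate m S b) (z i)
             * exp (- exit_rate (urn_rate m S b) (z i) * s i))"
begin

definition draw1 :: "nat \<times> nat \<Rightarrow> nat \<times> nat" where
  "draw1 z = (fst z + nat (S - b), snd z + nat b)"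

definition draw2 :: "nat \<times> nat \<Rightarrow> nat \<times> nat" where
  "draw2 z = (fst z + nat (S - m - b), snd z + nat (m + b))"

text \<open>
  The number of balls after \<open>i\<close> jumps, which by balance does not depend on the colours drawn.
\<close>
definition mass :: "nat \<Rightarrow> nat" where
  "mass i = fst z0 + snd z0 + i * nat S"

definition hold :: "nat \<Rightarrow> 'w \<Rightarrow> real" where
  "hold i \<omega> = T (Suc i) \<omega> - T i \<omega>"

definition jump_prob :: "nat \<times> nat \<Rightarrow> nat \<times> nat \<Rightarrow> real" where
  "jump_prob z z' = urn_rate m S b z z' / exit_rate (urn_rate m S b) z"

definition urn_path :: "(nat \<Rightarrow> nat \<times> nat) \<Rightarrow> nat \<Rightarrow> bool" where
  "urn_path z n \<longleftrightarrow> z 0 = z0 \<and> (\<forall>i<n. z (Suc i) \<in> {draw1 (z i), draw2 (z i)})"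

definition path_event :: "(nat \<Rightarrow> nat \<times> nat) \<Rightarrow> nat \<Rightarrow> 'w set" where
  "path_event z n = {\<omega> \<in> space M. \<forall>i<n. Y (Suc i) \<omega> = z (Suc i)}"

definition path_prob :: "(nat \<Rightarrow> nat \<times> nat) \<Rightarrow> nat \<Rightarrow> real" where
  "path_prob z n = (\<Prod>i<n. jump_prob (z i) (z (Suc i)))"

lemma hold_measurable [measurable]: "hold i \<in> borel_measurable M"
  unfolding hold_def by measurable

lemma path_event_measurable [measurable]: "path_event z n \<in> events"
  unfolding path_event_def by measurable

lemma hold_pos: "AE \<omega> in M. \<forall>i. 0 < hold i \<omega>"
  using T_strict by eventually_elim (simp add: hold_def)

lemma mass_pos: "0 < mass i"
  using start by (auto simp: mass_def prod_eq_iff)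

lemma draw1_neq_draw2: "draw1 z \<noteq> draw2 z"
  using large by (auto simp: draw1_def draw2_def)

lemma mass_draw:
  assumes "fst z + snd z = mass i" "z' \<in> {draw1 z, draw2 z}"
  shows "fst z' + snd z' = mass (Suc i)"
proof -
  have "nat (S - b) + nat b = nat S" "nat (S - m - b) + nat (m + b) = nat S"
    using large by auto
  then show ?thesis using assms by (auto simp: draw1_def draw2_def mass_def)
qed

lemma urn_path_mass:
  assumes "urn_path z n" "i \<le> n"
  shows "fst (z i) + snd (z i) = mass i"
  using assms(2)
proof (induction i)
  case 0
  then show ?case using assms(1) by (simp add: urn_path_def mass_def)
next
  case (Suc i)
  then show ?case using assms(1) mass_draw[of "z i" i "z (Suc i)"] by (auto simp: urn_path_def)
qed

lemma exit_rate_urn: "exit_rate (urn_rate m S b) z = real (fst z + snd z)"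
proof -
  have "exit_rate (urn_rate m S b) z = (\<Sum>z'\<in>{draw1 z, draw2 z}. urn_rate m S b z z')"
    by (rule exit_rate_finite_support) (auto simp: urn_rate_def draw1_def draw2_def split_beta)
  also have "\<dots> = real (fst z + snd z)"
    using draw1_neq_draw2[of z]
    by (auto simp: urn_rate_def draw1_def draw2_def split_beta)
  finally show ?thesis .
qed

lemma jump_prob_draw1: "jump_prob z (draw1 z) = real (fst z) / real (fst z + snd z)"
  and jump_prob_draw2: "jump_prob z (draw2 z) = real (snd z) / real (fst z + snd z)"
  unfolding jump_prob_def exit_rate_urn using draw1_neq_draw2[of z]
  by (auto simp: urn_rate_def draw1_def draw2_def split_beta)

lemma jump_prob_nonneg: "z' \<in> {draw1 z, draw2 z} \<Longrightarrow> 0 \<le> jump_prob z z'"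
  by (auto simp: jump_prob_draw1 jump_prob_draw2)

lemma jump_prob_sum: "fst z + snd z = mass i \<Longrightarrow> jump_prob z (draw1 z) + jump_prob z (draw2 z) = 1"
  using mass_pos[of i] unfolding jump_prob_draw1 jump_prob_draw2
  by (simp flip: add_divide_distrib of_nat_add)

lemma path_prob_nonneg: "urn_path z n \<Longrightarrow> 0 \<le> path_prob z n"
  unfolding path_prob_def urn_path_def by (intro prod_nonneg) (auto intro!: jump_prob_nonneg)

text \<open>
  Along an urn path the exit rates can be replaced by the deterministic numbers \<open>mass i\<close>; this
  makes the joint law a product of a factor for the path and a factor for the holding times.
\<close>
lemma path_event_tails:
  assumes z: "urn_path z n" and s: "\<forall>i<n. 0 \<le> s i"
  shows "prob {\<omega> \<in> path_event z n. \<forall>i<n. s i < hold i \<omega>}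
       = path_prob z n * (\<Prod>i<n. exp (- real (mass i) * s i))"
proof -
  have "prob {\<omega> \<in> path_event z n. \<forall>i<n. s i < hold i \<omega>}
      = (\<Prod>i<n. jump_prob (z i) (z (Suc i)) * exp (- exit_rate (urn_rate m S b) (z i) * s i))"
  proof -
    have "{\<omega> \<in> path_event z n. \<forall>i<n. s i < hold i \<omega>}
        = {\<omega> \<in> space M. \<forall>i<n. T (Suc i) \<omega> - T i \<omega> > s i \<and> Y (Suc i) \<omega> = z (Suc i)}"
      by (auto simp: path_event_def hold_def)
    then show ?thesis
      using jump_law[of z n s] z s by (simp only: urn_path_def jump_prob_def)
  qed
  also have "\<dots> = path_prob z n * (\<Prod>i<n. exp (- real (mass i) * s i))"
    unfolding prod.distrib path_prob_def
    by (intro arg_cong2[where f="(*)"] prod.cong refl) (simp add: exit_rate_urn urn_path_mass[OF z])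
  finally show ?thesis .
qed

lemma expectation_path_holding:
  assumes "urn_path z n" "\<And>i. g i \<in> borel_measurable borel" "\<And>i x. 0 \<le> g i x"
    "\<And>i x. 0 < x \<Longrightarrow> g i x \<le> 1"
  shows "expectation (\<lambda>\<omega>. indicator (path_event z n) \<omega> * (\<Prod>i<n. g i (hold i \<omega>)))
       = path_prob z n * (\<Prod>i<n. \<integral>x. g i x \<partial>exp_law (real (mass i)))"
  by (rule expectation_prod_exponential_times)
     (use assms hold_pos mass_pos path_event_tails in auto)

lemma prob_path_event:
  assumes "urn_path z n"
  shows "prob (path_event z n) = path_prob z n"
  using expectation_path_holding[OF assms, of "\<lambda>_ _. 1"]
    prob_space.prob_space[OF prob_space_exp_law] mass_pos by simp

lemma urn_path_extend:
  assumes "urn_path z n" "z' \<in> {draw1 (z n), draw2 (z n)}"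
  shows "urn_path (z(Suc n := z')) (Suc n)"
  using assms by (auto simp: urn_path_def less_Suc_eq)

lemma path_prob_extend: "path_prob (z(Suc n := z')) (Suc n) = path_prob z n * jump_prob (z n) z'"
  by (simp add: path_prob_def)

lemma path_event_extend:
  "path_event (z(Suc n := z')) (Suc n) = path_event z n \<inter> {\<omega> \<in> space M. Y (Suc n) \<omega> = z'}"
  by (auto simp: path_event_def less_Suc_eq)

text \<open>
  The two one-step extensions exhaust the event almost surely since their probabilities already
  add up to that of the event.
\<close>
lemma path_event_split:
  assumes z: "urn_path z n"
  shows "AE \<omega> in M. indicator (path_event z n) \<omega>
    = indicator (path_event (z(Suc n := draw1 (z n))) (Suc n)) \<omega>
      + (indicator (path_event (z(Suc n := draw2 (z n))) (Suc n)) \<omega> :: real)"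
proof -
  let ?E = "path_event z n" and ?F = "\<lambda>z'. path_event (z(Suc n := z')) (Suc n)"
  have F: "prob (?F z') = path_prob z n * jump_prob (z n) z'"
    if "z' \<in> {draw1 (z n), draw2 (z n)}" for z'
    using prob_path_event[OF urn_path_extend[OF z that]] by (simp only: path_prob_extend)
  have disj: "?F (draw1 (z n)) \<inter> ?F (draw2 (z n)) = {}"
    using draw1_neq_draw2[of "z n"] unfolding path_event_extend by auto
  have "prob (?E - (?F (draw1 (z n)) \<union> ?F (draw2 (z n))))
      = prob ?E - (prob (?F (draw1 (z n))) + prob (?F (draw2 (z n))))"
    using disj by (subst finite_measure_Diff)
      (auto simp: finite_measure_Union simp del: fun_upd_apply, auto simp: path_event_extend)
  also have "\<dots> = 0"
    using jump_prob_sum[OF urn_path_mass[OF z order_refl]]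
    by (simp add: F prob_path_event[OF z] flip: distrib_left)
  finally have "?E - (?F (draw1 (z n)) \<union> ?F (draw2 (z n))) \<in> null_sets M"
    by (intro null_setsI) (auto simp: emeasure_eq_measure)
  from AE_not_in[OF this] show ?thesis
    by eventually_elim (use disj in \<open>auto simp: indicator_def path_event_extend\<close>)
qed

text \<open>
  The hypothesis on \<open>V\<close> is a one-step supermartingale inequality under the weights \<open>g\<close>.
  Splitting the event of following \<open>z\<close> up to time \<open>j\<close> into its two extensions propagates
  the bound from \<open>n\<close> back to \<open>j\<close>.  The factors \<open>g i\<close> with \<open>i < j\<close> are arbitrary: later
  they localise the first holding times.  The case \<open>j = 0\<close> is excluded because
  \<open>path_event z 0\<close> says nothing about \<open>Y 0\<close>.
\<close>
lemma backward_supermartingale_bound: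
  fixes V :: "nat \<Rightarrow> nat \<times> nat \<Rightarrow> real"
  assumes g: "\<And>i. g i \<in> borel_measurable borel" "\<And>i x. 0 \<le> g i x" "\<And>i x. 0 < x \<Longrightarrow> g i x \<le> 1"
    and V: "\<And>i x. N \<le> i \<Longrightarrow> i < n \<Longrightarrow> fst x + snd x = mass i \<Longrightarrow>
      (\<integral>t. g i t \<partial>exp_law (real (mass i)))
        * (jump_prob x (draw1 x) * V (Suc i) (draw1 x) + jump_prob x (draw2 x) * V (Suc i) (draw2 x))
      \<le> V i x"
    and j: "0 < j" "N \<le> j" "j \<le> n" and z: "urn_path z j"
  defines "Z \<equiv> \<lambda>\<omega>. (\<Prod>i<n. g i (hold i \<omega>)) * V n (Y n \<omega>)"
  shows "integrable M (\<lambda>\<omega>. indicator (path_event z j) \<omega> * Z \<omega>)"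
    and "expectation (\<lambda>\<omega>. indicator (path_event z j) \<omega> * Z \<omega>)
      \<le> path_prob z j * (\<Prod>i<j. \<integral>t. g i t \<partial>exp_law (real (mass i))) * V j (z j)"
proof -
  let ?G = "\<lambda>j. \<Prod>i<j. \<integral>t. g i t \<partial>exp_law (real (mass i))"
  note [measurable] = g(1)
  have [measurable]: "Z \<in> borel_measurable M"
    unfolding Z_def by measurable
  have "integrable M (\<lambda>\<omega>. indicator (path_event z j) \<omega> * Z \<omega>) \<and>
    expectation (\<lambda>\<omega>. indicator (path_event z j) \<omega> * Z \<omega>) \<le> path_prob z j * ?G j * V j (z j)"
    using j z
  proof (induction "n - j" arbitrary: j z)
    case 0
    then have "j = n" by simp
    have eq: "indicator (path_event z n) \<omega> * Z \<omega>
        = indicator (path_event z n) \<omega> * (\<Prod>i<n. g i (hold i \<omega>)) * V n (z n)" for \<omega>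
      using \<open>0 < j\<close> \<open>j = n\<close> by (cases n) (auto simp: Z_def path_event_def indicator_def)
    have "integrable M (\<lambda>\<omega>. indicator (path_event z n) \<omega> * (\<Prod>i<n. g i (hold i \<omega>)))"
    proof (rule integrable_const_bound[where B=1])
      show "AE \<omega> in M. norm (indicator (path_event z n) \<omega> * (\<Prod>i<n. g i (hold i \<omega>))) \<le> 1"
        using hold_pos by eventually_elim
          (auto simp: indicator_def abs_of_nonneg prod_nonneg g intro!: prod_le_1)
    qed measurable
    then show ?case
      using expectation_path_holding[of z n g] 0 g unfolding \<open>j = n\<close> eq by auto
  next
    case (Suc k)
    let ?z = "\<lambda>z'. z(Suc j := z')"
    let ?x = "z j"
    have IH: "integrable M (\<lambda>\<omega>. indicator (path_event (?z z') (Suc j)) \<omega> * Z \<omega>)"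
      "expectation (\<lambda>\<omega>. indicator (path_event (?z z') (Suc j)) \<omega> * Z \<omega>)
        \<le> path_prob z j * jump_prob (z j) z' * ?G (Suc j) * V (Suc j) z'"
      if "z' \<in> {draw1 ?x, draw2 ?x}" for z'
    proof -
      have "k = n - Suc j" "0 < Suc j" "N \<le> Suc j" "Suc j \<le> n" using Suc by auto
      from Suc.hyps(1)[OF this urn_path_extend[OF Suc.prems(4) that]]
      show "integrable M (\<lambda>\<omega>. indicator (path_event (?z z') (Suc j)) \<omega> * Z \<omega>)"
        "expectation (\<lambda>\<omega>. indicator (path_event (?z z') (Suc j)) \<omega> * Z \<omega>)
          \<le> path_prob z j * jump_prob (z j) z' * ?G (Suc j) * V (Suc j) z'"
        unfolding path_prob_extend by auto
    qed
    let ?F = "\<lambda>z' \<omega>. indicator (path_event (?z z') (Suc j)) \<omega> * Z \<omega>"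
    have int: "integrable M (\<lambda>\<omega>. ?F (draw1 ?x) \<omega> + ?F (draw2 ?x) \<omega>)"
      by (intro Bochner_Integration.integrable_add IH) auto
    have ae: "AE \<omega> in M. indicator (path_event z j) \<omega> * Z \<omega> = ?F (draw1 ?x) \<omega> + ?F (draw2 ?x) \<omega>"
      using path_event_split[OF Suc.prems(4)] by eventually_elim (simp only: distrib_right)
    have "integrable M (\<lambda>\<omega>. indicator (path_event z j) \<omega> * Z \<omega>)"
      by (subst integrable_cong_AE[OF _ _ ae]) (use int in auto)
    moreover have "expectation (\<lambda>\<omega>. indicator (path_event z j) \<omega> * Z \<omega>)
        \<le> path_prob z j * ?G j * V j (z j)"
    proof -
      have "expectation (\<lambda>\<omega>. indicator (path_event z j) \<omega> * Z \<omega>)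
        = expectation (\<lambda>\<omega>. ?F (draw1 ?x) \<omega> + ?F (draw2 ?x) \<omega>)"
        by (rule integral_cong_AE[OF _ _ ae]) auto
      also have "\<dots> = expectation (?F (draw1 ?x)) + expectation (?F (draw2 ?x))"
        by (intro Bochner_Integration.integral_add IH) auto
      also have "\<dots> \<le> path_prob z j * jump_prob ?x (draw1 ?x) * ?G (Suc j) * V (Suc j) (draw1 ?x)
          + path_prob z j * jump_prob ?x (draw2 ?x) * ?G (Suc j) * V (Suc j) (draw2 ?x)"
        by (intro add_mono IH) auto
      also have "\<dots> = path_prob z j * ?G j * ((\<integral>t. g j t \<partial>exp_law (real (mass j)))
        * (jump_prob ?x (draw1 ?x) * V (Suc j) (draw1 ?x) + jump_prob ?x (draw2 ?x) * V (Suc j) (draw2 ?x)))"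
        by (simp add: algebra_simps)
      also have "\<dots> \<le> path_prob z j * ?G j * V j ?x"
        using Suc.prems Suc.hyps(2) path_prob_nonneg[OF Suc.prems(4)]
        by (intro mult_left_mono V mult_nonneg_nonneg prod_nonneg)
           (auto simp: g intro!: urn_path_mass)
      finally show ?thesis .
    qed
    ultimately show ?case by blast
  qed
  then show "integrable M (\<lambda>\<omega>. indicator (path_event z j) \<omega> * Z \<omega>)"
    and "expectation (\<lambda>\<omega>. indicator (path_event z j) \<omega> * Z \<omega>)
      \<le> path_prob z j * ?G j * V j (z j)" by auto
qed

section \<open>One-step moments of the eigenfunction\<close>

abbreviation u :: "nat \<times> nat \<Rightarrow> real" where "u \<equiv> u2 m S b"

lemma S_pos: "0 < S" and m_pos: "0 < m"
  using large by auto

lemma u_draw1: "u (draw1 z) = u z + b * m / S"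
proof -
  have "real (nat (S - b)) = S - b" "real (nat b) = b"
    using large by auto
  then show ?thesis
    using S_pos by (simp add: u2_def draw1_def split_beta field_simps)
qed

lemma u_draw2: "u (draw2 z) = u z - (S - m - b) * m / S"
proof -
  have "real (nat (S - m - b)) = S - m - b" "real (nat (m + b)) = m + b"
    using large by auto
  then show ?thesis
    using S_pos by (simp add: u2_def draw2_def split_beta field_simps)
qed

text \<open>
  That \<open>u\<close> is an eigenfunction of the mean increment with eigenvalue \<open>m\<close> is what makes
  \<open>exp (- m * T n) * u (Y n)\<close> a martingale: the factor \<open>(mass i + m) / mass i\<close> gained by \<open>u\<close>
  in a step is cancelled by the mean of \<open>exp (- m * t)\<close> over the holding time.
\<close>
lemma mean_drift:
  assumes "fst x + snd x = mass i"
  shows "jump_prob x (draw1 x) * (b * m / S) - jump_prob x (draw2 x) * ((S - m - b) * m / S)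
       = m * u x / mass i"
  unfolding jump_prob_draw1 jump_prob_draw2 assms
  using mass_pos[of i] S_pos by (simp add: u2_def split_beta field_simps)

lemma mean_step:
  assumes "fst x + snd x = mass i"
  shows "jump_prob x (draw1 x) * u (draw1 x) + jump_prob x (draw2 x) * u (draw2 x)
       = (mass i + m) / mass i * u x"
proof -
  have "jump_prob x (draw1 x) * u (draw1 x) + jump_prob x (draw2 x) * u (draw2 x)
      = (jump_prob x (draw1 x) + jump_prob x (draw2 x)) * u x
        + (jump_prob x (draw1 x) * (b * m / S) - jump_prob x (draw2 x) * ((S - m - b) * m / S))"
    unfolding u_draw1 u_draw2 by algebra
  also have "\<dots> = (mass i + m) / mass i * u x"
    unfolding jump_prob_sum[OF assms] mean_drift[OF assms]
    using mass_pos[of i] by (simp add: field_simps)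
  finally show ?thesis .
qed

text \<open>
  The cross term is again given by the drift, and the increments of \<open>u\<close> are at most \<open>m\<close> in
  absolute value.
\<close>
lemma second_moment_step:
  assumes "fst x + snd x = mass i"
  shows "jump_prob x (draw1 x) * (u (draw1 x))\<^sup>2 + jump_prob x (draw2 x) * (u (draw2 x))\<^sup>2
       \<le> (mass i + 2 * m) / mass i * (u x)\<^sup>2 + m\<^sup>2"
proof -
  define A where "A = real_of_int (b * m) / S"
  define B where "B = real_of_int ((S - m - b) * m) / S"
  define p where "p = jump_prob x (draw1 x)"
  define q where "q = jump_prob x (draw2 x)"
  have pq: "p + q = 1" "0 \<le> p" "0 \<le> q"
    using jump_prob_sum[OF assms] by (auto simp: p_def q_def jump_prob_nonneg)
  have "0 \<le> A" "A \<le> m" "0 \<le> B" "B \<le> m"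
    using large m_pos S_pos unfolding A_def B_def by (auto simp: divide_le_eq mult_le_cancel_right mult.commute[of m]
      simp del: of_int_diff of_int_mult simp flip: of_int_mult)
  then have AB: "A\<^sup>2 \<le> m\<^sup>2" "B\<^sup>2 \<le> m\<^sup>2" by (auto intro!: power_mono simp del: of_int_power simp add: of_int_power)
  have "p * (u x + A)\<^sup>2 + q * (u x - B)\<^sup>2
      = (p + q) * (u x)\<^sup>2 + 2 * u x * (p * A - q * B) + (p * A\<^sup>2 + q * B\<^sup>2)"
    by (simp add: power2_eq_square algebra_simps)
  also have "(p + q) * (u x)\<^sup>2 + 2 * u x * (p * A - q * B) = (mass i + 2 * m) / mass i * (u x)\<^sup>2"
  proof -
    have drift: "p * A - q * B = m * u x / mass i"
      using mean_drift[OF assms] by (simp only: A_def B_def p_def q_def)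
    show ?thesis
      unfolding pq(1) drift using mass_pos[of i] by (simp add: field_simps power2_eq_square)
  qed
  also have "p * A\<^sup>2 + q * B\<^sup>2 \<le> p * m\<^sup>2 + q * m\<^sup>2"
    by (intro add_mono mult_left_mono AB pq)
  also have "\<dots> = m\<^sup>2" using pq(1) by (simp flip: distrib_right)
  finally show ?thesis
    unfolding u_draw1 u_draw2 by (simp add: A_def B_def p_def q_def)
qed

section \<open>The process restarted after a prescribed initial path\<close>

definition window :: "(nat \<Rightarrow> nat \<times> nat) \<Rightarrow> nat \<Rightarrow> real \<Rightarrow> real \<Rightarrow> 'w set" where
  "window z N l r = {\<omega> \<in> path_event z N. \<forall>i<N. l < hold i \<omega> \<and> hold i \<omega> \<le> r}"

text \<open>The martingale of the process restarted at its \<open>N\<close>-th jump.\<close>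
definition restart :: "nat \<Rightarrow> nat \<Rightarrow> 'w \<Rightarrow> real" where
  "restart N n \<omega> = exp (- real_of_int m * (T n \<omega> - T N \<omega>)) * u (Y n \<omega>)"

text \<open>
  Weights on the holding times that localise the first \<open>N\<close> of them and discount the later ones;
  their product is a single expression in \<open>T n - T N\<close>, by \<open>prod_window_weight\<close>.
\<close>
definition window_weight :: "nat \<Rightarrow> real \<Rightarrow> real \<Rightarrow> real \<Rightarrow> nat \<Rightarrow> real \<Rightarrow> real" where
  "window_weight N l r k i x = (if i < N then indicator {l<..r} x else exp (- k * x))"

lemma window_measurable [measurable]: "window z N l r \<in> events"
proof -
  have "window z N l r = path_event z N \<inter> {\<omega> \<in> space M. \<forall>i<N. l < hold i \<omega> \<and> hold i \<omega> \<le> r}"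
    by (auto simp: window_def path_event_def)
  then show ?thesis by simp
qed

lemma restart_measurable [measurable]: "restart N n \<in> borel_measurable M"
  unfolding restart_def by measurable

lemma window_weight_admissible:
  "window_weight N l r k i \<in> borel_measurable borel" "0 \<le> window_weight N l r k i x"
  "0 \<le> k \<Longrightarrow> 0 < x \<Longrightarrow> window_weight N l r k i x \<le> 1"
  by (auto simp: window_weight_def[abs_def])

lemma prod_window_weight:
  assumes "N \<le> n"
  shows "indicator (path_event z N) \<omega> * (\<Prod>i<n. window_weight N l r k i (hold i \<omega>))
    = indicator (window z N l r) \<omega> * exp (- k * (T n \<omega> - T N \<omega>))"
proof -
  have "(\<Prod>i<N. indicator {l<..r} (hold i \<omega>)) = (of_bool (\<forall>i<N. l < hold i \<omega> \<and> hold i \<omega> \<le> r) :: real)"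
    by (induction N) (auto simp: indicator_def less_Suc_eq)
  moreover have "(\<Prod>i<N + d. window_weight N l r k i (hold i \<omega>))
      = (\<Prod>i<N. indicator {l<..r} (hold i \<omega>)) * exp (- k * (T (N + d) \<omega> - T N \<omega>))" for d
    by (induction d) (auto simp: window_weight_def hold_def mult_exp_exp algebra_simps)
  from this[of "n - N"] have "(\<Prod>i<n. window_weight N l r k i (hold i \<omega>))
      = (\<Prod>i<N. indicator {l<..r} (hold i \<omega>)) * exp (- k * (T n \<omega> - T N \<omega>))"
    using assms by simp
  ultimately show ?thesis
    by (auto simp: window_def indicator_def)
qed

lemma prob_window:
  fixes k :: real
  assumes "urn_path z N"
  shows "prob (window z N l r) = path_prob z N * (\<Prod>i<N. \<integral>t. window_weight N l r k i t \<partial>exp_law (mass i))"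
proof -
  have "(\<integral>t. window_weight N l r k i t \<partial>exp_law (mass i)) = (\<integral>t. window_weight N l r 0 i t \<partial>exp_law (mass i))" if "i < N" for i
    using that by (simp add: window_weight_def)
  then show ?thesis
    using expectation_path_holding[OF assms, of "window_weight N l r 0"] 
    by (simp add: prod_window_weight[of N N] window_weight_admissible)
qed

lemma expectation_window_weight:
  fixes k :: real
  assumes "N \<le> i" "0 \<le> k"
  shows "(\<integral>t. window_weight N l r k i t \<partial>exp_law (mass i)) = mass i / (mass i + k)"
  using assms expectation_exp_law_exp[of "mass i" k] mass_pos[of i] by (simp add: window_weight_def)

lemma window_bound:
  fixes V :: "nat \<Rightarrow> nat \<times> nat \<Rightarrow> real" and k :: real
  assumes k: "0 \<le> k" and N: "0 < N" "N \<le> n" and z: "urn_path z N"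
    and V: "\<And>i x. N \<le> i \<Longrightarrow> fst x + snd x = mass i \<Longrightarrow>
      mass i / (mass i + k) * (jump_prob x (draw1 x) * V (Suc i) (draw1 x)
        + jump_prob x (draw2 x) * V (Suc i) (draw2 x)) \<le> V i x"
  defines "Z \<equiv> \<lambda>\<omega>. exp (- k * (T n \<omega> - T N \<omega>)) * V n (Y n \<omega>)"
  shows "integrable M (\<lambda>\<omega>. indicator (window z N l r) \<omega> * Z \<omega>)"
    and "expectation (\<lambda>\<omega>. indicator (window z N l r) \<omega> * Z \<omega>) \<le> prob (window z N l r) * V N (z N)"
proof -
  have eq: "indicator (path_event z N) \<omega> * ((\<Prod>i<n. window_weight N l r k i (hold i \<omega>)) * V n (Y n \<omega>))
      = indicator (window z N l r) \<omega> * Z \<omega>" for \<omega>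
    using prod_window_weight[OF N(2), of z \<omega> l r k] unfolding Z_def by (simp only: mult.assoc[symmetric])
  have V': "(\<integral>t. window_weight N l r k i t \<partial>exp_law (mass i))
      * (jump_prob x (draw1 x) * V (Suc i) (draw1 x) + jump_prob x (draw2 x) * V (Suc i) (draw2 x))
      \<le> V i x" if "N \<le> i" "fst x + snd x = mass i" for i x
    unfolding expectation_window_weight[OF that(1) k] by (rule V[OF that])
  note bound = backward_supermartingale_bound[where g="window_weight N l r k" and V=V,
      OF window_weight_admissible(1) window_weight_admissible(2) window_weight_admissible(3)[OF k] V' N(1) order_refl N(2) z]
  show "integrable M (\<lambda>\<omega>. indicator (window z N l r) \<omega> * Z \<omega>)"
    using bound(1) by (simp only: eq)
  show "expectation (\<lambda>\<omega>. indicator (window z N l r) \<omega> * Z \<omega>) \<le> prob (window z N l r) * V N (z N)"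
    using bound(2) by (simp only: eq prob_window[OF z, of l r k])
qed

text \<open>
  A solution of the recursive inequality in \<open>variance_bound_step\<close>, which governs the second
  moments of the restarted martingale.  A linear function of \<open>mass i\<close> can satisfy it because
  \<open>2 * m > S\<close>, and the coefficient \<open>m\<^sup>2\<close> suffices since \<open>2 * m - S \<ge> 1\<close>; this plays the
  part of summing the series of the variances of the increments.
\<close>
definition variance_bound :: "nat \<Rightarrow> real" where
  "variance_bound i = m\<^sup>2 * (real (mass i) + 2 * m - S)"

lemma variance_bound_nonneg: "0 \<le> variance_bound i"
  using large unfolding variance_bound_def by (intro mult_nonneg_nonneg) auto

lemma variance_bound_step: "mass i / (mass i + 2 * m) * (m\<^sup>2 + variance_bound (Suc i)) \<le> variance_bound i"
proof -
  define L where "L = real (mass i)"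
  have L: "0 < L" using mass_pos[of i] by (simp add: L_def)
  have Suc: "real (mass (Suc i)) = L + S"
    using S_pos by (simp add: mass_def L_def algebra_simps)
  have m2: "0 < real_of_int m" using m_pos by simp
  have gap: "1 \<le> 2 * real_of_int m - S" using large by linarith
  have "L / (L + 2 * m) * (m\<^sup>2 + variance_bound (Suc i)) = L / (L + 2 * m) * m\<^sup>2 + m\<^sup>2 * L"
    unfolding variance_bound_def Suc using L m2 by (simp add: field_simps)
  also have "\<dots> \<le> m\<^sup>2 * 1 + m\<^sup>2 * L"
    using L m2 by (intro add_mono) (auto simp: field_simps)
  also have "\<dots> \<le> m\<^sup>2 * (2 * real_of_int m - S) + m\<^sup>2 * L"
    using mult_left_mono[OF gap, of "(real_of_int m)\<^sup>2"] by simp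
  also have "\<dots> = variance_bound i"
    by (simp add: variance_bound_def L_def algebra_simps)
  finally show ?thesis by (simp add: L_def)
qed

text \<open>
  Expanding the square leaves the first and second moments of the restarted martingale.  For the
  first moment \<open>V\<close> is a multiple \<open>c * u\<close> of either sign (with \<open>k = m\<close>), for the second it is
  \<open>u\<^sup>2 + variance_bound\<close> (with \<open>k = 2 * m\<close>).
\<close>
lemma window_variance:
  fixes l r :: real
  assumes N: "0 < N" "N \<le> n" and z: "urn_path z N"
  defines "D \<equiv> \<lambda>\<omega>. indicator (window z N l r) \<omega> * (restart N n \<omega> - u (z N))\<^sup>2"
  shows "integrable M D" and "expectation D \<le> prob (window z N l r) * variance_bound N"
proof -
  let ?A = "window z N l r" and ?v = "u (z N)"
  have L0: "0 < real (mass i)" for i using mass_pos[of i] by simp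
  have m0: "0 < real_of_int m" using m_pos by simp
  have first: "mass i / (mass i + real_of_int m) * (jump_prob x (draw1 x) * (c * u (draw1 x))
        + jump_prob x (draw2 x) * (c * u (draw2 x))) \<le> c * u x"
    if "fst x + snd x = mass i" for c i x
  proof -
    have "jump_prob x (draw1 x) * (c * u (draw1 x)) + jump_prob x (draw2 x) * (c * u (draw2 x))
        = c * ((mass i + m) / mass i * u x)"
      unfolding mean_step[OF that, symmetric] by algebra
    then show ?thesis using L0[of i] m0 by (simp add: field_simps)
  qed
  have second: "mass i / (mass i + 2 * real_of_int m) * (jump_prob x (draw1 x) * ((u (draw1 x))\<^sup>2 + variance_bound (Suc i))
        + jump_prob x (draw2 x) * ((u (draw2 x))\<^sup>2 + variance_bound (Suc i))) \<le> (u x)\<^sup>2 + variance_bound i"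
    if "fst x + snd x = mass i" for i x
  proof -
    let ?c = "mass i / (mass i + 2 * real_of_int m)"
    have "jump_prob x (draw1 x) * ((u (draw1 x))\<^sup>2 + variance_bound (Suc i))
        + jump_prob x (draw2 x) * ((u (draw2 x))\<^sup>2 + variance_bound (Suc i))
      = jump_prob x (draw1 x) * (u (draw1 x))\<^sup>2 + jump_prob x (draw2 x) * (u (draw2 x))\<^sup>2
        + (jump_prob x (draw1 x) + jump_prob x (draw2 x)) * variance_bound (Suc i)"
      by algebra
    also have "\<dots> \<le> (mass i + 2 * m) / mass i * (u x)\<^sup>2 + m\<^sup>2 + variance_bound (Suc i)"
      using second_moment_step[OF that] jump_prob_sum[OF that] by simp
    finally have "?c * (jump_prob x (draw1 x) * ((u (draw1 x))\<^sup>2 + variance_bound (Suc i))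
        + jump_prob x (draw2 x) * ((u (draw2 x))\<^sup>2 + variance_bound (Suc i)))
      \<le> ?c * ((mass i + 2 * m) / mass i * (u x)\<^sup>2 + m\<^sup>2 + variance_bound (Suc i))"
      using m0 by (intro mult_left_mono) auto
    also have "\<dots> = (u x)\<^sup>2 + ?c * (m\<^sup>2 + variance_bound (Suc i))"
    proof -
      have "?c * ((mass i + 2 * m) / mass i) = 1" using L0[of i] m0 by simp
      then show ?thesis by algebra
    qed
    also have "\<dots> \<le> (u x)\<^sup>2 + variance_bound i"
      using variance_bound_step[of i] by simp
    finally show ?thesis .
  qed
  have mean: "integrable M (\<lambda>\<omega>. indicator ?A \<omega> * (exp (- real_of_int m * (T n \<omega> - T N \<omega>)) * (c * u (Y n \<omega>))))"
    "expectation (\<lambda>\<omega>. indicator ?A \<omega> * (exp (- real_of_int m * (T n \<omega> - T N \<omega>)) * (c * u (Y n \<omega>))))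
      \<le> prob ?A * (c * ?v)" for c
    using window_bound[OF _ N z, where k="real_of_int m" and V="\<lambda>i x. c * u x"] first m0 by auto
  have square: "integrable M (\<lambda>\<omega>. indicator ?A \<omega> * (exp (- (2 * real_of_int m) * (T n \<omega> - T N \<omega>)) * ((u (Y n \<omega>))\<^sup>2 + variance_bound n)))"
    "expectation (\<lambda>\<omega>. indicator ?A \<omega> * (exp (- (2 * real_of_int m) * (T n \<omega> - T N \<omega>)) * ((u (Y n \<omega>))\<^sup>2 + variance_bound n)))
      \<le> prob ?A * (?v\<^sup>2 + variance_bound N)"
    using window_bound[OF _ N z, where k="2 * real_of_int m" and V="\<lambda>i x. (u x)\<^sup>2 + variance_bound i"] second m0 by auto
  let ?E = "\<lambda>\<omega>. indicator ?A \<omega> * (exp (- (2 * real_of_int m) * (T n \<omega> - T N \<omega>)) * ((u (Y n \<omega>))\<^sup>2 + variance_bound n))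
    + indicator ?A \<omega> * (exp (- real_of_int m * (T n \<omega> - T N \<omega>)) * ((- 2 * ?v) * u (Y n \<omega>)))
    + indicator ?A \<omega> * ?v\<^sup>2"
  have const: "integrable M (\<lambda>\<omega>. indicator ?A \<omega> * ?v\<^sup>2)"
    by (intro integrable_mult_left integrable_real_indicator) (auto simp: emeasure_eq_measure)
  have intE: "integrable M ?E"
    by (intro Bochner_Integration.integrable_add square mean const)
  have DE: "D \<omega> \<le> ?E \<omega>" for \<omega>
  proof -
    let ?e = "exp (- real_of_int m * (T n \<omega> - T N \<omega>))"
    have e: "exp (- (2 * real_of_int m) * (T n \<omega> - T N \<omega>)) = ?e\<^sup>2"
      by (simp add: power2_eq_square mult_exp_exp algebra_simps)
    have "(?e * u (Y n \<omega>) - ?v)\<^sup>2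
        = ?e\<^sup>2 * ((u (Y n \<omega>))\<^sup>2 + variance_bound n) + ?e * ((- 2 * ?v) * u (Y n \<omega>)) + ?v\<^sup>2 - ?e\<^sup>2 * variance_bound n"
      by algebra
    also have "\<dots> \<le> ?e\<^sup>2 * ((u (Y n \<omega>))\<^sup>2 + variance_bound n) + ?e * ((- 2 * ?v) * u (Y n \<omega>)) + ?v\<^sup>2"
      using variance_bound_nonneg[of n] by simp
    finally show ?thesis unfolding D_def restart_def e by (simp add: indicator_def)
  qed
  show intD: "integrable M D"
    by (rule Bochner_Integration.integrable_bound[OF intE])
       (use DE in \<open>auto simp: D_def intro!: AE_I2 order_trans[OF _ abs_ge_self]\<close>)
  have "expectation D \<le> expectation ?E"
    by (intro integral_mono intD intE DE)
  also have "\<dots> = expectation (\<lambda>\<omega>. indicator ?A \<omega> * (exp (- (2 * real_of_int m) * (T n \<omega> - T N \<omega>)) * ((u (Y n \<omega>))\<^sup>2 + variance_bound n)))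
    + expectation (\<lambda>\<omega>. indicator ?A \<omega> * (exp (- real_of_int m * (T n \<omega> - T N \<omega>)) * ((- 2 * ?v) * u (Y n \<omega>))))
    + expectation (\<lambda>\<omega>. indicator ?A \<omega> * ?v\<^sup>2)"
    by (simp only: Bochner_Integration.integral_add square(1) mean(1) const
        Bochner_Integration.integrable_add)
  also have "\<dots> \<le> prob ?A * (?v\<^sup>2 + variance_bound N) + prob ?A * ((- 2 * ?v) * ?v) + prob ?A * ?v\<^sup>2"
    using square(2) mean(2)[of "- 2 * ?v"] by (intro add_mono) auto
  also have "\<dots> = prob ?A * variance_bound N"
    by (simp add: power2_eq_square algebra_simps)
  finally show "expectation D \<le> prob ?A * variance_bound N" .
qed

section \<open>The limit comes close to every nonzero real\<close>

text \<open>
  If the limit \<open>exp (m * T N) * W\<close> of the restarted martingale stayed at distance at least \<open>\<eta>\<close>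
  from its mean on the window, then by Fatou's lemma \<open>\<eta>\<^sup>2\<close> would be bounded by the uniform bound
  on the variances.
\<close>
lemma limit_near_restart_mean:
  fixes W :: "'w \<Rightarrow> real"
  assumes W [measurable]: "W \<in> borel_measurable M"
    and lim: "AE \<omega> in M. (\<lambda>n. exp (- real_of_int m * T n \<omega>) * u (Y n \<omega>)) \<longlonglongrightarrow> W \<omega>"
    and N: "0 < N" and z: "urn_path z N"
    and pos: "0 < prob (window z N l r)" and \<eta>: "variance_bound N < \<eta>\<^sup>2" "0 < \<eta>"
  shows "0 < prob {\<omega> \<in> window z N l r. \<bar>exp (m * T N \<omega>) * W \<omega> - u (z N)\<bar> < \<eta>}"
proof (rule ccontr)
  let ?A = "window z N l r" and ?v = "u (z N)"
  let ?R = "\<lambda>\<omega>. exp (m * T N \<omega>) * W \<omega>"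
  let ?B = "{\<omega> \<in> ?A. \<bar>?R \<omega> - ?v\<bar> < \<eta>}"
  let ?D = "\<lambda>n \<omega>. indicator ?A \<omega> * (restart N n \<omega> - ?v)\<^sup>2 :: real"
  have "?B = ?A \<inter> {\<omega> \<in> space M. \<bar>?R \<omega> - ?v\<bar> < \<eta>}"
    by (auto simp: window_def path_event_def)
  then have [measurable]: "?B \<in> events" by simp
  assume "\<not> 0 < prob ?B"
  then have "prob ?B = 0" using measure_nonneg[of M ?B] by linarith
  then have "?B \<in> null_sets M"
    by (intro null_setsI) (auto simp: emeasure_eq_measure)
  from AE_not_in[OF this] have far: "AE \<omega> in M. \<omega> \<in> ?A \<longrightarrow> \<eta> \<le> \<bar>?R \<omega> - ?v\<bar>"
    by eventually_elim auto
  have conv: "AE \<omega> in M. (\<lambda>n. ?D n \<omega>) \<longlonglongrightarrow> indicator ?A \<omega> * (?R \<omega> - ?v)\<^sup>2"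
    using lim
  proof eventually_elim
    case (elim \<omega>)
    have "restart N n \<omega> = exp (m * T N \<omega>) * (exp (- real_of_int m * T n \<omega>) * u (Y n \<omega>))" for n
      unfolding restart_def mult.assoc[symmetric] mult_exp_exp by (simp add: algebra_simps)
    then show ?case
      by (simp only:) (intro tendsto_intros elim)
  qed
  have "ennreal (\<eta>\<^sup>2 * prob ?A) = (\<integral>\<^sup>+\<omega>. ennreal (\<eta>\<^sup>2) * indicator ?A \<omega> \<partial>M)"
    by (subst nn_integral_cmult_indicator) (auto simp: emeasure_eq_measure ennreal_mult)
  also have "\<dots> \<le> (\<integral>\<^sup>+\<omega>. liminf (\<lambda>n. ennreal (?D n \<omega>)) \<partial>M)"
  proof (rule nn_integral_mono_AE)
    show "AE \<omega> in M. ennreal (\<eta>\<^sup>2) * indicator ?A \<omega> \<le> liminf (\<lambda>n. ennreal (?D n \<omega>))"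
      using far conv
    proof eventually_elim
      case (elim \<omega>)
      have "(\<lambda>n. ennreal (?D n \<omega>)) \<longlonglongrightarrow> ennreal (indicator ?A \<omega> * (?R \<omega> - ?v)\<^sup>2)"
        by (intro tendsto_ennrealI elim)
      from lim_imp_Liminf[OF _ this] have "liminf (\<lambda>n. ennreal (?D n \<omega>)) = ennreal (indicator ?A \<omega> * (?R \<omega> - ?v)\<^sup>2)"
        by simp
      moreover have "\<eta>\<^sup>2 \<le> (?R \<omega> - ?v)\<^sup>2" if "\<omega> \<in> ?A"
        using power_mono[of \<eta> "\<bar>?R \<omega> - ?v\<bar>" 2] elim(1) that \<eta> by simp
      ultimately show ?case by (auto simp: indicator_def ennreal_leI)
    qed
  qed
  also have "\<dots> \<le> liminf (\<lambda>n. \<integral>\<^sup>+\<omega>. ennreal (?D n \<omega>) \<partial>M)"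
    by (rule nn_integral_liminf) measurable
  also have "\<dots> \<le> ennreal (prob ?A * variance_bound N)"
  proof (rule Liminf_le)
    have "(\<integral>\<^sup>+\<omega>. ennreal (?D n \<omega>) \<partial>M) \<le> ennreal (prob ?A * variance_bound N)" if "N \<le> n" for n
      using window_variance[OF N that z, of l r]
      by (subst nn_integral_eq_integral) (auto intro: ennreal_leI)
    then show "\<forall>\<^sub>F n in sequentially. (\<integral>\<^sup>+\<omega>. ennreal (?D n \<omega>) \<partial>M) \<le> ennreal (prob ?A * variance_bound N)"
      by (rule eventually_sequentiallyI)
  qed simp
  finally have "\<eta>\<^sup>2 * prob ?A \<le> variance_bound N * prob ?A"
    using variance_bound_nonneg[of N] by (subst (asm) ennreal_le_iff) (simp_all add: mult.commute)
  then show False using pos \<eta>(1) by simp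
qed

lemma prob_window_pos:
  assumes z: "urn_path z N" "0 < path_prob z N" and lr: "0 \<le> l" "l < r"
  shows "0 < prob (window z N l r)"
proof -
  have "0 < (\<integral>t. window_weight N l r 0 i t \<partial>exp_law (mass i))" if "i < N" for i
  proof -
    have L: "0 < real (mass i)" using mass_pos[of i] by simp
    interpret E: prob_space "exp_law (mass i)" by (rule prob_space_exp_law[OF L])
    have "(\<integral>t. window_weight N l r 0 i t \<partial>exp_law (mass i)) = E.prob {l<..r}"
      using that by (simp add: window_weight_def)
    also have "{l<..r} = {l<..} - {r<..}" using lr by auto
    also have "E.prob \<dots> = E.prob {l<..} - E.prob {r<..}"
      using lr by (intro E.finite_measure_Diff) auto
    also have "\<dots> > 0"
      using lr L by (simp add: measure_exp_law_tail)
    finally show ?thesis .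
  qed
  then show ?thesis
    unfolding prob_window[OF z(1), of l r 0] using z(2) by (intro mult_pos_pos prod_pos) auto
qed

lemma jump_time_in_window:
  assumes "\<omega> \<in> window z N l r" "T 0 \<omega> = 0" "0 < N"
  shows "N * l < T N \<omega>" "T N \<omega> \<le> N * r"
proof -
  have T: "T N \<omega> = (\<Sum>i<N. hold i \<omega>)"
    using assms(2) sum_lessThan_telescope[of "\<lambda>i. T i \<omega>" N] by (simp add: hold_def)
  have "(\<Sum>i<N. l) < (\<Sum>i<N. hold i \<omega>)"
    by (rule sum_strict_mono) (use assms in \<open>auto simp: window_def\<close>)
  moreover have "(\<Sum>i<N. hold i \<omega>) \<le> (\<Sum>i<N. r)"
    by (rule sum_mono) (use assms in \<open>auto simp: window_def\<close>)
  ultimately show "N * l < T N \<omega>" "T N \<omega> \<le> N * r" by (simp_all add: T)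
qed

text \<open>
  Always drawing the same colour moves \<open>u\<close> linearly in the direction of \<open>w\<close>, while
  \<open>variance_bound\<close> is only linear, so its square root is eventually negligible.
\<close>
lemma far_path:
  assumes w: "w \<noteq> 0" and \<delta>: "0 < \<delta>"
  obtains N z where "0 < N" "urn_path z N" "0 < path_prob z N"
    "1 + \<delta> < u (z N) / w" "variance_bound N < (\<delta> * \<bar>u (z N)\<bar>)\<^sup>2"
proof -
  define h where "h = (if 0 < w then draw1 else draw2)"
  \<comment> \<open>The increment of \<open>u / w\<close> at each draw of the chosen colour.\<close>
  define \<kappa> where "\<kappa> = (if 0 < w then b * m / S else - ((S - m - b) * m / S)) / w"
  \<comment> \<open>A colour that is absent at the start cannot be drawn at once, so the first draw is of a
    colour that is present; it makes both colours present from then on.\<close>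
  define x1 where "x1 = (if fst z0 = 0 then draw2 z0 else draw1 z0)"
  define z where "z n = (case n of 0 \<Rightarrow> z0 | Suc i \<Rightarrow> (h ^^ i) x1)" for n
  define c where "c = u x1 / w"
  have gain: "u (h x) / w = u x / w + \<kappa>" for x
    by (auto simp: h_def \<kappa>_def u_draw1 u_draw2 add_divide_distrib diff_divide_distrib)
  have "0 < \<kappa>"
  proof -
    have "0 < real_of_int (b * m) / S" "0 < real_of_int ((S - m - b) * m) / S"
      using large m_pos S_pos by (auto intro!: divide_pos_pos mult_pos_pos simp del: of_int_diff)
    then show ?thesis
      unfolding \<kappa>_def using w
      by (cases "0 < w") (auto simp only: if_True if_False neg_less_0_iff_less linorder_neq_iff
        intro: divide_pos_pos divide_neg_neg)
  qed
  have height: "u (z (Suc i)) / w = c + i * \<kappa>" for i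
    by (induction i) (auto simp: z_def c_def gain algebra_simps)
  have inner: "0 < fst (z (Suc i)) \<and> 0 < snd (z (Suc i))" for i
  proof -
    have draw_pos: "0 < fst (draw1 x) \<and> 0 < snd (draw1 x)" "0 < fst (draw2 x) \<and> 0 < snd (draw2 x)" for x
      using large by (auto simp: draw1_def draw2_def)
    show ?thesis by (cases i) (auto simp: z_def x1_def h_def draw_pos)
  qed
  have path: "urn_path z n" for n
    by (auto simp: urn_path_def z_def x1_def h_def split: nat.split)
  have step_pos: "0 < jump_prob (z i) (z (Suc i))" for i
  proof (cases i)
    case 0
    then show ?thesis using start
      by (auto simp: z_def x1_def jump_prob_draw1 jump_prob_draw2 prod_eq_iff)
  next
    case (Suc j)
    then show ?thesis using inner[of j]
      by (auto simp: z_def h_def jump_prob_draw1 jump_prob_draw2)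
  qed
  define B where "B = real (mass 1) + 2 * m - S"
  have variance_bound: "variance_bound (Suc i) = m\<^sup>2 * (B + real i * real_of_int S)" for i
    using S_pos by (simp add: variance_bound_def B_def mass_def algebra_simps)
  define a where "a = \<delta>\<^sup>2 * w\<^sup>2"
  have a: "0 < a" using w \<delta> by (simp add: a_def)
  have "\<forall>\<^sub>F i :: nat in sequentially. 1 + \<delta> < c + i * \<kappa>"
    using \<open>0 < \<kappa>\<close> by real_asymp
  moreover have "\<forall>\<^sub>F i :: nat in sequentially. (real_of_int m)\<^sup>2 * (B + real i * real_of_int S) < a * (c + i * \<kappa>)\<^sup>2"
    using \<open>0 < \<kappa>\<close> a by real_asymp
  ultimately have "\<forall>\<^sub>F i :: nat in sequentially. 1 + \<delta> < c + i * \<kappa> \<and>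
      (real_of_int m)\<^sup>2 * (B + real i * real_of_int S) < a * (c + i * \<kappa>)\<^sup>2"
    by (rule eventually_conj)
  then obtain i :: nat where i: "1 + \<delta> < c + i * \<kappa>" "(real_of_int m)\<^sup>2 * (B + real i * real_of_int S) < a * (c + i * \<kappa>)\<^sup>2"
    by (auto simp: eventually_sequentially)
  have "u (z (Suc i)) = w * (c + i * \<kappa>)"
    using height[of i] w by (simp add: field_simps)
  then have "a * (c + i * \<kappa>)\<^sup>2 = (\<delta> * \<bar>u (z (Suc i))\<bar>)\<^sup>2"
    by (simp add: a_def power_mult_distrib)
  moreover have "0 < path_prob z (Suc i)"
    unfolding path_prob_def by (intro prod_pos) (auto simp: step_pos)
  ultimately show thesis
    using i by (intro that[of "Suc i" z] path) (auto simp: height variance_bound)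
qed

text \<open>
  The window is chosen such that \<open>exp (- m * T N)\<close> lies between \<open>1 / \<rho>\<close> and \<open>(1 + \<delta>) / \<rho>\<close>,
  where \<open>\<rho> = v / w\<close>; then \<open>W\<close> has relative error at most \<open>2 * \<delta> + \<delta>\<^sup>2 \<le> 3 * \<delta>\<close>.
\<close>
lemma limit_hits_neighbourhood:
  fixes W :: "'w \<Rightarrow> real"
  assumes W [measurable]: "W \<in> borel_measurable M"
    and lim: "AE \<omega> in M. (\<lambda>n. exp (- real_of_int m * T n \<omega>) * u (Y n \<omega>)) \<longlonglongrightarrow> W \<omega>"
    and w: "w \<noteq> 0" and \<epsilon>: "0 < \<epsilon>"
  shows "0 < prob {\<omega> \<in> space M. \<bar>W \<omega> - w\<bar> < \<epsilon>}"
proof -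
  define \<delta> where "\<delta> = min 1 (\<epsilon> / (4 * \<bar>w\<bar>))"
  have \<delta>: "0 < \<delta>" "\<delta> \<le> 1" using w \<epsilon> by (auto simp: \<delta>_def)
  have "\<delta> * \<bar>w\<bar> \<le> \<epsilon> / (4 * \<bar>w\<bar>) * \<bar>w\<bar>"
    by (intro mult_right_mono) (auto simp: \<delta>_def)
  then have \<delta>w: "3 * \<delta> * \<bar>w\<bar> < \<epsilon>" using w \<epsilon> by simp
  from far_path[OF w \<delta>(1)] obtain N z where N: "0 < N" and z: "urn_path z N" "0 < path_prob z N"
    and far: "1 + \<delta> < u (z N) / w" and small: "variance_bound N < (\<delta> * \<bar>u (z N)\<bar>)\<^sup>2" .
  define v where "v = u (z N)"
  define \<rho> where "\<rho> = v / w"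
  have \<rho>: "1 + \<delta> < \<rho>" using far by (simp add: \<rho>_def v_def)
  have v: "v = \<rho> * w" using w by (simp add: \<rho>_def)
  have "v \<noteq> 0" using w \<rho> \<delta> by (auto simp: v)
  have m0: "0 < real_of_int m" using m_pos by simp
  \<comment> \<open>Holding times in \<open>(l, r]\<close> put \<open>m * T N\<close> between \<open>ln (\<rho> / (1 + \<delta>))\<close> and \<open>ln \<rho>\<close>; the lower end
    is nonnegative since \<open>\<rho> > 1 + \<delta>\<close>.\<close>
  define l where "l = ln (\<rho> / (1 + \<delta>)) / (m * N)"
  define r where "r = ln \<rho> / (m * N)"
  have l0: "0 \<le> l" using \<rho> \<delta> m0 N by (auto simp: l_def intro!: divide_nonneg_pos ln_ge_zero)
  have lr: "l < r"
    unfolding l_def r_def using \<rho> \<delta> m0 N by (intro divide_strict_right_mono) (auto simp: ln_div)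
  let ?B = "{\<omega> \<in> window z N l r. \<bar>exp (m * T N \<omega>) * W \<omega> - u (z N)\<bar> < \<delta> * \<bar>v\<bar>}"
  have "0 < prob ?B"
    using \<delta> \<open>v \<noteq> 0\<close> small
    by (intro limit_near_restart_mean[OF W lim N z(1)] prob_window_pos[OF z l0 lr]) (auto simp: v_def)
  also have "prob ?B \<le> prob {\<omega> \<in> space M. \<bar>W \<omega> - w\<bar> < \<epsilon>}"
  proof (rule finite_measure_mono_AE)
    show "AE \<omega> in M. \<omega> \<in> ?B \<longrightarrow> \<omega> \<in> {\<omega> \<in> space M. \<bar>W \<omega> - w\<bar> < \<epsilon>}"
      using T_0 AE_space
    proof (eventually_elim, intro impI CollectI conjI)
      fix \<omega> assume T0: "T 0 \<omega> = 0" and \<omega>: "\<omega> \<in> space M" "\<omega> \<in> ?B"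
      define E where "E = exp (- real_of_int m * T N \<omega>)"
      define X where "X = exp (m * T N \<omega>) * W \<omega>"
      have X: "\<bar>X - v\<bar> < \<delta> * \<bar>v\<bar>" using \<omega> by (simp add: X_def v_def)
      have WX: "W \<omega> = E * X" by (simp add: X_def E_def mult_exp_exp flip: mult.assoc)
      have "N * l < T N \<omega>" "T N \<omega> \<le> N * r"
        using \<omega> jump_time_in_window[of \<omega> z N l r] T0 N by auto
      then have "ln (\<rho> / (1 + \<delta>)) < m * T N \<omega>" "m * T N \<omega> \<le> ln \<rho>"
        using m0 N by (auto simp: l_def r_def field_simps)
      then have "exp (- ln \<rho>) \<le> E" "E \<le> exp (- ln (\<rho> / (1 + \<delta>)))"
        by (auto simp: E_def)
      then have E: "1 / \<rho> \<le> E" "E \<le> (1 + \<delta>) / \<rho>"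
        using \<rho> \<delta> by (auto simp: exp_minus inverse_eq_divide)
      have "\<bar>W \<omega> - w\<bar> = \<bar>E * (X - v) + (E - 1 / \<rho>) * v\<bar>"
        using \<rho> \<delta> by (simp add: WX v algebra_simps)
      also have "\<dots> \<le> \<bar>E\<bar> * \<bar>X - v\<bar> + \<bar>E - 1 / \<rho>\<bar> * \<bar>v\<bar>"
        by (metis abs_mult abs_triangle_ineq)
      also have "\<dots> \<le> (1 + \<delta>) / \<rho> * (\<delta> * \<bar>v\<bar>) + \<delta> / \<rho> * \<bar>v\<bar>"
        using E X \<rho> \<delta> by (intro add_mono mult_mono) (auto simp: E_def add_divide_distrib)
      also have "\<dots> = (2 * \<delta> + \<delta> * \<delta>) * \<bar>w\<bar>"
        using \<rho> \<delta> by (simp add: v abs_mult field_simps)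
      also have "\<dots> \<le> 3 * \<delta> * \<bar>w\<bar>"
        using \<delta> mult_left_mono[of \<delta> 1 \<delta>] by (intro mult_right_mono) auto
      finally show "\<bar>W \<omega> - w\<bar> < \<epsilon>" using \<delta>w by linarith
    qed
  qed measurable
  finally show ?thesis .
qed

end

theorem proposition7p1:
  fixes m S b :: int and \<alpha> \<beta> :: nat
    and M :: "'w measure" and U :: "real \<Rightarrow> 'w \<Rightarrow> nat \<times> nat" and W :: "'w \<Rightarrow> real"
  assumes "m + 2 \<le> S" and "S \<le> 2 * m - 1"
    and "1 \<le> b" and "b \<le> S - m - 1"
    and "(\<alpha>, \<beta>) \<noteq> (0, 0)"
    and "markov_jump_process M (urn_rate m S b) (\<alpha>, \<beta>) U"
    and "W \<in> borel_measurable M"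
    and "AE \<omega> in M. ((\<lambda>t. exp (- real_of_int m * t) * u2 m S b (U t \<omega>)) \<longlongrightarrow> W \<omega>) at_top"
  shows "measure_support (distr M borel W) = UNIV"
proof -
  note [measurable] = assms(7)
  from assms(6) obtain T Y where prob: "prob_space M"
    and TY: "\<forall>n. T n \<in> borel_measurable M" "\<forall>n. Y n \<in> measurable M (count_space UNIV)"
    and ae: "AE \<omega> in M. T 0 \<omega> = 0 \<and> Y 0 \<omega> = (\<alpha>, \<beta>) \<and> (\<forall>n. T n \<omega> < T (Suc n) \<omega>) \<and>
      filterlim (\<lambda>n. T n \<omega>) at_top sequentially \<and>
      (\<forall>n t. T n \<omega> \<le> t \<and> t < T (Suc n) \<omega> \<longrightarrow> U t \<omega> = Y n \<omega>)"
    and law: "\<forall>(n :: nat) z s. z 0 = (\<alpha>, \<beta>) \<longrightarrow> (\<forall>i<n. 0 \<le> s i) \<longrightarrow>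
      measure M {\<omega> \<in> space M. \<forall>i<n. T (Suc i) \<omega> - T i \<omega> > s i \<and> Y (Suc i) \<omega> = z (Suc i)}
        = (\<Prod>i<n. urn_rate m S b (z i) (z (Suc i)) / exit_rate (urn_rate m S b) (z i)
             * exp (- exit_rate (urn_rate m S b) (z i) * s i))"
    unfolding markov_jump_process_def by blast
  interpret prob_space M by (rule prob)
  interpret urn_jump_chain M m S b "(\<alpha>, \<beta>)" T Y
  proof
    show "AE \<omega> in M. T 0 \<omega> = 0" using ae by eventually_elim blast
    show "AE \<omega> in M. \<forall>n. T n \<omega> < T (Suc n) \<omega>" using ae by eventually_elim blast
  qed (use assms TY law in blast)+
  have lim: "AE \<omega> in M. (\<lambda>n. exp (- real_of_int m * T n \<omega>) * u (Y n \<omega>)) \<longlonglongrightarrow> W \<omega>"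
    using ae assms(8)
  proof eventually_elim
    case (elim \<omega>)
    have "(\<lambda>n. exp (- real_of_int m * T n \<omega>) * u (U (T n \<omega>) \<omega>)) \<longlonglongrightarrow> W \<omega>"
      by (rule filterlim_compose[OF elim(2)]) (use elim(1) in blast)
    moreover have "U (T n \<omega>) \<omega> = Y n \<omega>" for n using elim(1) by blast
    ultimately show ?case by simp
  qed
  have "0 < emeasure (distr M borel W) V" if V: "open V" "x \<in> V" for x V
  proof -
    obtain e where e: "0 < e" "ball x e \<subseteq> V" using V open_contains_ball by blast
    \<comment> \<open>The approximation is available at nonzero points only; near \<open>0\<close> there is one in \<open>V\<close>.\<close>
    define w where "w = (if x = 0 then e / 2 else x)"
    have "w \<noteq> 0" and near: "\<bar>x - w\<bar> \<le> e / 2" using e by (auto simp: w_def)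
    have sub: "y \<in> V" if "\<bar>y - w\<bar> < e / 2" for y
    proof (rule subsetD[OF e(2)])
      show "y \<in> ball x e"
        using that near unfolding mem_ball dist_real_def by linarith
    qed
    have "0 < prob {\<omega> \<in> space M. \<bar>W \<omega> - w\<bar> < e / 2}"
      using e by (intro limit_hits_neighbourhood[OF assms(7) lim \<open>w \<noteq> 0\<close>]) simp
    also have "\<dots> \<le> prob (W -` V \<inter> space M)"
      using V sub by (intro finite_measure_mono) auto
    finally show ?thesis
      using V by (simp add: emeasure_distr emeasure_eq_measure)
  qed
  then show ?thesis by (auto simp: measure_support_def)
qed

end
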